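(* For every integer $n\geq 1$, $$\frac{(1+y)^{n}}{t}A_{n}(t^{2})+\sum_{k=0}^{n}\binom{n}{k}(1+y)^{k}(1-t^{2})^{n-k}A_{k}(t^{2})$$ $$=(1+yt)(1+t)(1+yt^{2})^{n-1}\,P_{n}^{(\mathrm{lpk},\mathrm{val},\mathrm{des})}\left(\frac{t(1+y)(y+t)}{(y+t^{2})(1+yt)},\frac{t(1+y)(1+yt)}{(1+yt^{2})(y+t)},\frac{y+t^{2}}{1+yt^{2}}\right).$$
   Context: $\mathfrak{S}_n$ is the set of permutations $\pi=\pi_1\cdots\pi_n$ of $[n]=\{1,\dots,n\}$. For $\pi\in\mathfrak{S}_n$: $\mathrm{des}(\pi)$ is the number of $i\in[n-1]$ with $\pi_i>\pi_{i+1}$; $\mathrm{lpk}(\pi)$ is the number of left peaks, where $i\in[n-1]$ is a left peak if either $2\le i\le n-1$ and $\pi_{i-1}<\pi_i>\pi_{i+1}$, or $i=1$ and $\pi_1>\pi_2$; $\mathrm{val}(\pi)$ is the number of valleys, i.e. of $i$ with $2\le i\le n-1$ and $\pi_{i-1}>\pi_i<\pi_{i+1}$. $A_n(t)=\sum_{\pi\in\mathfrak{S}_n}t^{\mathrm{des}(\pi)+1}$ for $n\ge1$ and $A_0(t)=1$. For $n\ge1$, $P_n^{(\mathrm{lpk},\mathrm{val},\mathrm{des})}(y,z,t)=\sum_{\pi\in\mathfrak{S}_n}y^{\mathrm{lpk}(\pi)}z^{\mathrm{val}(\pi)}t^{\mathrm{des}(\pi)}$. The identity is one of rational functions in the indeterminates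 $y,t$. *)

theory Defs
  imports
    "HOL-Computational_Algebra.Polynomial_Factorial"
    "HOL-Combinatorics.Permutations"
begin

text \<open>
  The symmetric group on \<open>[n]\<close> is the set of all \<open>\<pi> :: nat \<Rightarrow> nat\<close> with \<open>\<pi> permutes {1..n}\<close>; the
  letter \<open>\<pi>\<^sub>i\<close> is \<open>\<pi> i\<close>.
\<close>

definition des :: "nat \<Rightarrow> (nat \<Rightarrow> nat) \<Rightarrow> nat" where
  "des n \<pi> = card {i \<in> {1..n - 1}. \<pi> i > \<pi> (i + 1)}"

definition lpk :: "nat \<Rightarrow> (nat \<Rightarrow> nat) \<Rightarrow> nat" where
  "lpk n \<pi> = card {i \<in> {1..n - 1}.
     (2 \<le> i \<and> \<pi> (i - 1) < \<pi> i \<and> \<pi> i > \<pi> (i + 1)) \<or> (i = 1 \<and> \<pi> 1 > \<pi> 2)}"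

definition val :: "nat \<Rightarrow> (nat \<Rightarrow> nat) \<Rightarrow> nat" where
  "val n \<pi> = card {i \<in> {2..n - 1}. \<pi> (i - 1) > \<pi> i \<and> \<pi> i < \<pi> (i + 1)}"

text \<open>
  The Eulerian polynomials and the joint enumerator of \<open>(lpk, val, des)\<close> are given by their values
  at elements of an arbitrary commutative ring, so that rational functions can be substituted.
\<close>

definition eulerian :: "nat \<Rightarrow> 'a::comm_ring_1 \<Rightarrow> 'a" where
  "eulerian n t = (if n = 0 then 1 else \<Sum>\<pi> | \<pi> permutes {1..n}. t ^ (des n \<pi> + 1))"

definition P_lpk_val_des :: "nat \<Rightarrow> 'a::comm_ring_1 \<Rightarrow> 'a \<Rightarrow> 'a \<Rightarrow> 'a" where
  "P_lpk_val_des n y z t =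
     (\<Sum>\<pi> | \<pi> permutes {1..n}. y ^ lpk n \<pi> * z ^ val n \<pi> * t ^ des n \<pi>)"

text \<open>
  The field of rational functions in two indeterminates over the rationals is the fraction field
  of \<open>\<rat>[y][t]\<close>: the indeterminate of the inner polynomial ring is \<open>y\<close>, that of the outer one is \<open>t\<close>.
\<close>

type_synonym ratfun = "rat poly poly fract"

definition Y :: ratfun where
  "Y = to_fract [:[:0, 1:]:]"

definition T :: ratfun where
  "T = to_fract [:0, 1:]"

end

theory Submission
  imports
    Defs
    "HOL-Combinatorics.Multiset_Permutations"
    "HOL-Computational_Algebra.Formal_Power_Series"
begin

text \<open>
  Splitting a permutation at its least letter shows that the exponential generating functions
  \<open>P\<close> of the \<open>P\<^sub>n(y, z, t)\<close> and \<open>F\<close> of the \<open>P\<^sub>n(1, y z, t)\<close> (\<open>n \<ge> 1\<close>) satisfy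
  \<open>P' = 1 + P + y t F + y z t F P\<close> and \<open>F' = 1 + (1 + t) F + y z t F\<^sup>2\<close>.
  Under the given substitution, the coefficients of \<open>F\<close> are a rescaling of the Eulerian polynomials
  in \<open>t\<^sup>2\<close>, and the linear equation for \<open>P\<close> has a solution of the form
  \<open>\<beta> F + \<alpha> (exp ((1 - c) x) (1 + c F) - 1)\<close> up to a constant factor; comparing coefficients gives the
  identity.
\<close>

unbundle fps_syntax

section \<open>Descents, peaks and valleys of words\<close>

fun descents :: "'a::linorder list \<Rightarrow> nat" where
  "descents (a # b # xs) = of_bool (b < a) + descents (b # xs)"
| "descents _ = 0"

fun peaks :: "'a::linorder list \<Rightarrow> nat" where
  "peaks (a # b # c # xs) = of_bool (a < b \<and> c < b) + peaks (b # c # xs)"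
| "peaks _ = 0"

fun valleys :: "'a::linorder list \<Rightarrow> nat" where
  "valleys (a # b # c # xs) = of_bool (b < a \<and> b < c) + valleys (b # c # xs)"
| "valleys _ = 0"

lemma descents_append_Cons:
  "\<sigma> \<noteq> [] \<Longrightarrow> descents (\<sigma> @ m # \<tau>) = descents \<sigma> + of_bool (m < last \<sigma>) + descents (m # \<tau>)"
  by (induction \<sigma> rule: descents.induct) auto

lemma descents_Cons_less:
  "(\<And>x. x \<in> set \<tau> \<Longrightarrow> m < x) \<Longrightarrow> descents (m # \<tau>) = descents \<tau>"
  by (cases \<tau>) (use order.asym in \<open>auto 4 3\<close>)

lemma valleys_Cons_less:
  "(\<And>x. x \<in> set \<tau> \<Longrightarrow> m < x) \<Longrightarrow> valleys (m # \<tau>) = valleys \<tau>"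
  by (cases \<tau> rule: descents.cases) (use order.asym in \<open>auto 4 3\<close>)

text \<open>The first letter enters only through its comparison with the second. This allows the
  least letter to be exchanged for the sentinel 0.\<close>

lemma peaks_Cons_less_cong:
  "(\<And>x. x \<in> set \<tau> \<Longrightarrow> m < x) \<Longrightarrow> (\<And>x. x \<in> set \<tau> \<Longrightarrow> m' < x) \<Longrightarrow>
    peaks (m # \<tau>) = peaks (m' # \<tau>)"
  by (cases \<tau> rule: descents.cases) (use order.asym in \<open>auto 4 3\<close>)

text \<open>The least letter \<open>m\<close> is a valley as soon as it has neighbours on both
  sides, and its neighbours are never valleys, each having the smaller \<open>m\<close> beside
  it.\<close>

lemma valleys_append_Cons:
  assumes "\<sigma> \<noteq> []" "\<And>x. x \<in> set \<sigma> \<Longrightarrow> m < x" "\<And>x. x \<in> set \<tau> \<Longrightarrow> m < x"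
  shows "valleys (\<sigma> @ m # \<tau>) = valleys \<sigma> + of_bool (\<tau> \<noteq> []) + valleys \<tau>"
  using assms(1,2)
proof (induction \<sigma> rule: valleys.induct)
  case ("2_2" a)
  have "valleys (m # \<tau>) = valleys \<tau>" using assms(3) by (rule valleys_Cons_less)
  then show ?case using "2_2" assms(3) by (cases \<tau>) auto
next
  case ("2_3" a b)
  have "valleys (m # \<tau>) = valleys \<tau>" using assms(3) by (rule valleys_Cons_less)
  moreover have "m < a" "m < b" using "2_3" by auto
  ultimately show ?case using assms(3) by (cases \<tau>) auto
qed auto

text \<open>Between the initial letter and the descent into \<open>m\<close>, peaks and valleys alternate.\<close>
lemma peaks_append_Cons:
  assumes "\<sigma> \<noteq> []" "distinct (a # \<sigma>)" "\<And>x. x \<in> set \<sigma> \<Longrightarrow> m < x"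
  shows "peaks (a # \<sigma> @ m # \<tau>) = valleys (a # \<sigma>) + of_bool (a < hd \<sigma>) + peaks (m # \<tau>)"
  using assms
proof (induction \<sigma> arbitrary: a)
  case (Cons b \<sigma>)
  show ?case
  proof (cases \<sigma>)
    case Nil
    then show ?thesis using Cons.prems by (cases \<tau>) auto
  next
    case (Cons c \<sigma>')
    have "peaks (b # \<sigma> @ m # \<tau>) = valleys (b # \<sigma>) + of_bool (b < hd \<sigma>) + peaks (m # \<tau>)"
      using Cons Cons.prems by (intro Cons.IH) auto
    then show ?thesis using Cons Cons.prems by auto
  qed
qed simp

section \<open>Weight enumerators of words, split at the least letter\<close>

text \<open>For words in positive letters, the 0 in front makes an initial descent count as a peak,
  so that \<open>peaks\<close> counts left peaks.\<close>

definition lpk_val_des_weight :: "'a::comm_ring_1 \<Rightarrow> 'a \<Rightarrow> 'a \<Rightarrow> nat list \<Rightarrow> 'a" where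
  "lpk_val_des_weight y z t xs = y ^ peaks (0 # xs) * z ^ valleys xs * t ^ descents xs"

definition lpk_val_des_sum :: "'a::comm_ring_1 \<Rightarrow> 'a \<Rightarrow> 'a \<Rightarrow> nat set \<Rightarrow> 'a" where
  "lpk_val_des_sum y z t A = (\<Sum>xs\<in>permutations_of_set A. lpk_val_des_weight y z t xs)"

text \<open>With the least letter in front, the word 0, \<open>m\<close>, \<open>\<tau>\<close>
  starts with ascents, so \<open>m\<close> creates no peak, valley or descent and acts on
  \<open>\<tau>\<close> just as 0 does.\<close>

lemma lpk_val_des_weight_Cons:
  assumes "0 < m" "\<And>x. x \<in> set \<tau> \<Longrightarrow> m < x"
  shows "lpk_val_des_weight y z t (m # \<tau>) = lpk_val_des_weight y z t \<tau>"
proof -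
  have "\<And>x. x \<in> set \<tau> \<Longrightarrow> 0 < x" using assms by force
  then have "peaks (m # \<tau>) = peaks (0 # \<tau>)"
    using assms(2) by (intro peaks_Cons_less_cong) auto
  moreover have "peaks (0 # m # \<tau>) = peaks (m # \<tau>)"
    using assms(2) by (cases \<tau>) (use order.asym in \<open>auto 4 3\<close>)
  ultimately show ?thesis
    unfolding lpk_val_des_weight_def
    using descents_Cons_less[of \<tau> m] valleys_Cons_less[of \<tau> m] assms(2) by simp
qed

text \<open>Between 0 and \<open>m\<close>, the block \<open>\<sigma>\<close> has one more peak than
  valleys: its peak weight merges into the valley weight \<open>y * z\<close> and leaves one factor
  \<open>y\<close>. The factor \<open>t\<close> is the descent into \<open>m\<close>; the factor
  \<open>z\<close> is \<open>m\<close> itself, a valley when \<open>\<tau>\<close> is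
  nonempty.\<close>

lemma lpk_val_des_weight_append_Cons:
  assumes "0 < m" "\<sigma> \<noteq> []" "distinct \<sigma>"
    and less: "\<And>x. x \<in> set \<sigma> \<Longrightarrow> m < x" "\<And>x. x \<in> set \<tau> \<Longrightarrow> m < x"
  shows "lpk_val_des_weight y z t (\<sigma> @ m # \<tau>) =
    y * t * (if \<tau> = [] then 1 else z) *
      (lpk_val_des_weight 1 (y * z) t \<sigma> * lpk_val_des_weight y z t \<tau>)"
proof -
  have pos: "\<And>x. x \<in> set \<sigma> \<Longrightarrow> 0 < x" "\<And>x. x \<in> set \<tau> \<Longrightarrow> 0 < x"
    using assms(1) less by force+
  have "peaks (m # \<tau>) = peaks (0 # \<tau>)"
    using less(2) pos(2) by (rule peaks_Cons_less_cong)
  moreover have "valleys (0 # \<sigma>) = valleys \<sigma>"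
    using pos(1) by (rule valleys_Cons_less)
  ultimately have "peaks (0 # \<sigma> @ m # \<tau>) = valleys \<sigma> + 1 + peaks (0 # \<tau>)"
    using peaks_append_Cons[of \<sigma> 0 m \<tau>] assms pos(1) by fastforce
  moreover have "valleys (\<sigma> @ m # \<tau>) = valleys \<sigma> + of_bool (\<tau> \<noteq> []) + valleys \<tau>"
    using assms by (intro valleys_append_Cons) auto
  moreover have "descents (\<sigma> @ m # \<tau>) = descents \<sigma> + 1 + descents \<tau>"
    using assms descents_append_Cons[of \<sigma> m \<tau>] descents_Cons_less[of \<tau> m] by simp
  ultimately show ?thesis
    by (simp add: lpk_val_des_weight_def power_add power_mult_distrib mult_ac)
qed

text \<open>The bijection cuts a word at \<open>m\<close>; \<open>B\<close> records which letters
  stand before it.\<close>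

lemma sum_permutations_of_set_insert:
  assumes "finite A" "m \<notin> A"
  shows "(\<Sum>xs\<in>permutations_of_set (insert m A). g xs) =
    (\<Sum>B\<in>Pow A. \<Sum>\<sigma>\<in>permutations_of_set B. \<Sum>\<tau>\<in>permutations_of_set (A - B).
       g (\<sigma> @ m # \<tau>))"
proof -
  let ?S = "SIGMA B:Pow A. permutations_of_set B \<times> permutations_of_set (A - B)"
  have "(\<Sum>(B, \<sigma>, \<tau>)\<in>?S. g (\<sigma> @ m # \<tau>)) = (\<Sum>xs\<in>permutations_of_set (insert m A). g xs)"
  proof (rule sum.reindex_bij_witness[where j = "\<lambda>(B, \<sigma>, \<tau>). \<sigma> @ m # \<tau>" and
      i = "\<lambda>xs. (set (takeWhile (\<lambda>x. x \<noteq> m) xs), takeWhile (\<lambda>x. x \<noteq> m) xs, tl (dropWhile (\<lambda>x. x \<noteq> m) xs))"])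
    fix a assume "a \<in> ?S"
    then obtain B \<sigma> \<tau> where a: "a = (B, \<sigma>, \<tau>)" and B: "B \<subseteq> A"
      and \<sigma>: "set \<sigma> = B" "distinct \<sigma>" and \<tau>: "set \<tau> = A - B" "distinct \<tau>"
      by (auto simp: permutations_of_set_def)
    have "m \<notin> set \<sigma>" using \<sigma> B assms by auto
    then have "takeWhile (\<lambda>x. x \<noteq> m) (\<sigma> @ m # \<tau>) = \<sigma>" "dropWhile (\<lambda>x. x \<noteq> m) (\<sigma> @ m # \<tau>) = m # \<tau>"
      by (induction \<sigma>) auto
    then show "(case case a of (B, \<sigma>, \<tau>) \<Rightarrow> \<sigma> @ m # \<tau> of xs \<Rightarrow> (set (takeWhile (\<lambda>x. x \<noteq> m) xs), takeWhile (\<lambda>x. x \<noteq> m) xs, tl (dropWhile (\<lambda>x. x \<noteq> m) xs))) = a"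
      using a \<sigma> by simp
    show "(case a of (B, \<sigma>, \<tau>) \<Rightarrow> \<sigma> @ m # \<tau>) \<in> permutations_of_set (insert m A)"
      using a B \<sigma> \<tau> assms by (auto simp: permutations_of_set_def)
  next
    fix xs assume "xs \<in> permutations_of_set (insert m A)"
    then have xs: "set xs = insert m A" "distinct xs" by (auto simp: permutations_of_set_def)
    then obtain \<sigma> \<tau> where eq: "xs = \<sigma> @ m # \<tau>" by (metis insertI1 split_list)
    then have m: "m \<notin> set \<sigma>" "m \<notin> set \<tau>" using xs by auto
    then have *: "takeWhile (\<lambda>x. x \<noteq> m) xs = \<sigma>" "dropWhile (\<lambda>x. x \<noteq> m) xs = m # \<tau>"
      unfolding eq by (induction \<sigma>) auto
    show "(case (set (takeWhile (\<lambda>x. x \<noteq> m) xs), takeWhile (\<lambda>x. x \<noteq> m) xs, tl (dropWhile (\<lambda>x. x \<noteq> m) xs)) of (B, \<sigma>, \<tau>) \<Rightarrow> \<sigma> @ m # \<tau>) = xs"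
      using * eq by simp
    have "insert m (set \<sigma> \<union> set \<tau>) = insert m A" using xs(1) eq by auto
    then have "A = set \<sigma> \<union> set \<tau>" using m assms(2) by auto
    then show "(set (takeWhile (\<lambda>x. x \<noteq> m) xs), takeWhile (\<lambda>x. x \<noteq> m) xs, tl (dropWhile (\<lambda>x. x \<noteq> m) xs)) \<in> ?S"
      using * eq xs(2) by (auto simp: permutations_of_set_def)
  qed auto
  moreover have "(\<Sum>(B, \<sigma>, \<tau>)\<in>?S. g (\<sigma> @ m # \<tau>)) =
    (\<Sum>B\<in>Pow A. \<Sum>(\<sigma>, \<tau>)\<in>permutations_of_set B \<times> permutations_of_set (A - B). g (\<sigma> @ m # \<tau>))"
    using assms(1) by (subst sum.Sigma) (auto simp: case_prod_unfold)
  ultimately show ?thesis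
    by (simp add: sum.cartesian_product)
qed

lemma sum_Pow_card:
  fixes f :: "nat \<Rightarrow> 'a::semiring_1"
  assumes "finite A"
  shows "(\<Sum>B\<in>Pow A. f (card B)) = (\<Sum>k\<le>card A. of_nat (card A choose k) * f k)"
proof -
  have "(\<Sum>B\<in>Pow A. f (card B)) = (\<Sum>k\<le>card A. \<Sum>B | B \<in> Pow A \<and> card B = k. f (card B))"
    using assms by (intro sum.group[symmetric]) (auto intro: card_mono)
  also have "\<dots> = (\<Sum>k\<le>card A. of_nat (card A choose k) * f k)"
    using n_subsets[OF assms] by (intro sum.cong) auto
  finally show ?thesis .
qed

lemma lpk_val_des_sum_empty [simp]: "lpk_val_des_sum y z t {} = 1"
  by (simp add: lpk_val_des_sum_def lpk_val_des_weight_def)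

lemma lpk_val_des_sum_insert:
  assumes "finite A" "0 < m" and less: "\<And>x. x \<in> A \<Longrightarrow> m < x"
  shows "lpk_val_des_sum y z t (insert m A) =
    (\<Sum>B\<in>Pow A. if B = {} then lpk_val_des_sum y z t A else
       y * t * (if A - B = {} then 1 else z) *
         (lpk_val_des_sum 1 (y * z) t B * lpk_val_des_sum y z t (A - B)))"
proof -
  have "m \<notin> A" using less by auto
  then have "lpk_val_des_sum y z t (insert m A) =
    (\<Sum>B\<in>Pow A. \<Sum>\<sigma>\<in>permutations_of_set B. \<Sum>\<tau>\<in>permutations_of_set (A - B).
       lpk_val_des_weight y z t (\<sigma> @ m # \<tau>))"
    unfolding lpk_val_des_sum_def using assms(1) by (intro sum_permutations_of_set_insert)
  also have "\<dots> = (\<Sum>B\<in>Pow A. if B = {} then lpk_val_des_sum y z t A else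
       y * t * (if A - B = {} then 1 else z) *
         (lpk_val_des_sum 1 (y * z) t B * lpk_val_des_sum y z t (A - B)))"
  proof (intro sum.cong refl)
    fix B assume "B \<in> Pow A"
    then have B: "B \<subseteq> A" by simp
    show "(\<Sum>\<sigma>\<in>permutations_of_set B. \<Sum>\<tau>\<in>permutations_of_set (A - B).
       lpk_val_des_weight y z t (\<sigma> @ m # \<tau>)) = (if B = {} then lpk_val_des_sum y z t A else
       y * t * (if A - B = {} then 1 else z) *
         (lpk_val_des_sum 1 (y * z) t B * lpk_val_des_sum y z t (A - B)))"
    proof (cases "B = {}")
      case True
      then show ?thesis
        using less assms(2) unfolding lpk_val_des_sum_def
        by (auto intro!: sum.cong lpk_val_des_weight_Cons dest: permutations_of_setD)
    next
      case False
      have "lpk_val_des_weight y z t (\<sigma> @ m # \<tau>) = y * t * (if A - B = {} then 1 else z) *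
         (lpk_val_des_weight 1 (y * z) t \<sigma> * lpk_val_des_weight y z t \<tau>)"
        if "\<sigma> \<in> permutations_of_set B" "\<tau> \<in> permutations_of_set (A - B)" for \<sigma> \<tau>
      proof -
        have *: "set \<sigma> = B" "distinct \<sigma>" "set \<tau> = A - B"
          using that by (auto simp: permutations_of_set_def)
        have "\<tau> = [] \<longleftrightarrow> A - B = {}" unfolding *(3)[symmetric] by simp
        moreover have "\<sigma> \<noteq> []" using False *(1) by auto
        ultimately show ?thesis
          using lpk_val_des_weight_append_Cons[of m \<sigma> \<tau> y z t] * B assms(2) less
          by (simp add: subset_eq)
      qed
      then have "(\<Sum>\<sigma>\<in>permutations_of_set B. \<Sum>\<tau>\<in>permutations_of_set (A - B).
          lpk_val_des_weight y z t (\<sigma> @ m # \<tau>)) =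
        (\<Sum>\<sigma>\<in>permutations_of_set B. \<Sum>\<tau>\<in>permutations_of_set (A - B).
          y * t * (if A - B = {} then 1 else z) *
            (lpk_val_des_weight 1 (y * z) t \<sigma> * lpk_val_des_weight y z t \<tau>))"
        by (intro sum.cong refl)
      also have "\<dots> = y * t * (if A - B = {} then 1 else z) *
          (lpk_val_des_sum 1 (y * z) t B * lpk_val_des_sum y z t (A - B))"
        unfolding lpk_val_des_sum_def by (simp only: sum_product) (simp only: sum_distrib_left)
      finally show ?thesis using False by (simp only: if_False)
    qed
  qed
  finally show ?thesis .
qed

text \<open>Keeping \<open>h\<close> abstract lets this serve twice: in the induction showing that
  only the size of the letter set matters, and then for the recurrence on intervals.
  \<open>IH\<close> ranges over all \<open>y\<close> and \<open>z\<close> because the left block has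
  parameters \<open>1\<close> and \<open>y * z\<close>.\<close>

lemma lpk_val_des_sum_card_insert:
  assumes "finite A" "0 < m" and less: "\<And>x. x \<in> A \<Longrightarrow> m < x"
    and IH: "\<And>B y z. B \<subseteq> A \<Longrightarrow> lpk_val_des_sum y z t B = h y z (card B)"
  shows "lpk_val_des_sum y z t (insert m A) =
    (\<Sum>k\<le>card A. of_nat (card A choose k) * (if k = 0 then h y z (card A) else
       y * t * (if card A - k = 0 then 1 else z) * (h 1 (y * z) k * h y z (card A - k))))"
proof -
  have "lpk_val_des_sum y z t (insert m A) =
    (\<Sum>B\<in>Pow A. if card B = 0 then h y z (card A) else
       y * t * (if card A - card B = 0 then 1 else z) * (h 1 (y * z) (card B) * h y z (card A - card B)))"
    unfolding lpk_val_des_sum_insert[OF assms(1,2) less, simplified]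
  proof (intro sum.cong refl)
    fix B assume "B \<in> Pow A"
    then have fin: "B \<subseteq> A" "finite B" "finite (A - B)"
      using assms(1) finite_subset by auto
    then have B: "B \<subseteq> A" "finite B" "card (A - B) = card A - card B" "finite (A - B)"
      by (simp_all add: card_Diff_subset)
    have "card B = 0 \<longleftrightarrow> B = {}" "card A - card B = 0 \<longleftrightarrow> A - B = {}"
      using B by (simp_all flip: B(3) add: card_eq_0_iff del: Diff_eq_empty_iff)
    then show "(if B = {} then lpk_val_des_sum y z t A else
       y * t * (if A - B = {} then 1 else z) *
         (lpk_val_des_sum 1 (y * z) t B * lpk_val_des_sum y z t (A - B))) =
       (if card B = 0 then h y z (card A) else
       y * t * (if card A - card B = 0 then 1 else z) * (h 1 (y * z) (card B) * h y z (card A - card B)))"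
      using IH[of B] IH[of "A - B"] IH[of A] B by simp
  qed
  also have "\<dots> = (\<Sum>k\<le>card A. of_nat (card A choose k) * (if k = 0 then h y z (card A) else
       y * t * (if card A - k = 0 then 1 else z) * (h 1 (y * z) k * h y z (card A - k))))"
    using assms(1) by (rule sum_Pow_card)
  finally show ?thesis .
qed

text \<open>Instead of relabelling letters, the proof splits at the minimum and uses induction on
  the size.\<close>

lemma lpk_val_des_sum_cong_card:
  assumes "finite A" "0 \<notin> A"
  shows "lpk_val_des_sum y z t A = lpk_val_des_sum y z t {1..card A}"
  using assms
proof (induction "card A" arbitrary: A y z rule: less_induct)
  case less
  \<comment> \<open>The right-hand side involves only \<open>card A\<close>, so using this for both
    \<open>A\<close> and \<open>{1..card A}\<close> closes the induction.\<close>
  have *: "lpk_val_des_sum y z t A' =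
    (\<Sum>k\<le>card A - 1. of_nat (card A - 1 choose k) * (if k = 0 then lpk_val_des_sum y z t {1..card A - 1} else
       y * t * (if card A - 1 - k = 0 then 1 else z) *
        (lpk_val_des_sum 1 (y * z) t {1..k} * lpk_val_des_sum y z t {1..card A - 1 - k})))"
    if A': "finite A'" "0 \<notin> A'" "card A' = card A" "A' \<noteq> {}" for A'
  proof -
    let ?m = "Min A'"
    have m: "?m \<in> A'" using A' by simp
    then have ins: "A' = insert ?m (A' - {?m})" by auto
    have pos: "0 < ?m" using A' m by (metis gr0I)
    have ls: "?m < x" if "x \<in> A' - {?m}" for x
      using that A' Min_le[of A' x] by (auto simp: order.strict_iff_order)
    have card: "card (A' - {?m}) = card A - 1" using m A' by simp
    have "card A > 0" using A' by (simp add: card_gt_0_iff flip: A'(3))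
    have IH: "lpk_val_des_sum y z t B = lpk_val_des_sum y z t {1..card B}"
      if "B \<subseteq> A' - {?m}" for B y z
    proof (rule less.hyps)
      have "card B \<le> card (A' - {?m})" using that A' by (intro card_mono) auto
      then show "card B < card A" using card \<open>card A > 0\<close> by simp
    qed (use that A' finite_subset[of B A'] in auto)
    have "finite (A' - {?m})" using A' by simp
    from lpk_val_des_sum_card_insert[where h = "\<lambda>y z k. lpk_val_des_sum y z t {1..k}", OF this pos ls IH]
    show ?thesis unfolding card ins[symmetric] by simp
  qed
  show ?case
  proof (cases "A = {}")
    case False
    then have "Suc 0 \<le> card A" using less.prems by (simp add: Suc_le_eq card_gt_0_iff)
    then have "lpk_val_des_sum y z t {1..card A} = lpk_val_des_sum y z t A"
      using False less.prems by (subst (1 2) *) auto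
    then show ?thesis ..
  qed simp
qed

lemma lpk_val_des_sum_Suc:
  "lpk_val_des_sum y z t {1..Suc n} =
    (\<Sum>k\<le>n. of_nat (n choose k) * (if k = 0 then lpk_val_des_sum y z t {1..n} else
       y * t * (if n - k = 0 then 1 else z) *
        (lpk_val_des_sum 1 (y * z) t {1..k} * lpk_val_des_sum y z t {1..n - k})))"
proof -
  have ins: "{1..Suc n} = insert 1 {2..Suc n}" and card: "card {2..Suc n} = n" by auto
  have "lpk_val_des_sum y z t B = lpk_val_des_sum y z t {1..card B}"
    if "B \<subseteq> {2..Suc n}" for B y z
    using that by (intro lpk_val_des_sum_cong_card) (auto intro: finite_subset)
  note * = lpk_val_des_sum_card_insert[where h = "\<lambda>y z k. lpk_val_des_sum y z t {1..k}", OF _ _ _ this,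
      where m = 1 and A = "{2..Suc n}", unfolded card]
  show ?thesis unfolding ins by (rule *) auto
qed

section \<open>Permutations as words\<close>

lemma descents_conv_sum: "descents xs = (\<Sum>i<length xs - 1. of_bool (xs ! Suc i < xs ! i))"
  by (induction xs rule: descents.induct) (auto simp: sum.lessThan_Suc_shift simp del: sum.lessThan_Suc)

lemma peaks_conv_sum:
  "peaks xs = (\<Sum>i<length xs - 2. of_bool (xs ! i < xs ! (i + 1) \<and> xs ! (i + 2) < xs ! (i + 1)))"
  by (induction xs rule: peaks.induct) (auto simp: sum.lessThan_Suc_shift simp del: sum.lessThan_Suc)

lemma valleys_conv_sum:
  "valleys xs = (\<Sum>i<length xs - 2. of_bool (xs ! (i + 1) < xs ! i \<and> xs ! (i + 1) < xs ! (i + 2)))"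
  by (induction xs rule: valleys.induct) (auto simp: sum.lessThan_Suc_shift simp del: sum.lessThan_Suc)

lemma card_filter_conv_sum:
  fixes n :: nat
  shows "card {i \<in> {m..n}. P i} = (\<Sum>i<Suc n - m. of_bool (P (i + m)))"
proof -
  have "card {i \<in> {m..n}. P i} = (\<Sum>i\<in>{m..n}. of_bool (P i))"
    by (simp add: of_bool_def Int_def conj_commute flip: sum.inter_filter)
  also have "\<dots> = (\<Sum>i<Suc n - m. of_bool (P (i + m)))"
    by (rule sum.reindex_bij_witness[of _ "\<lambda>i. i + m" "\<lambda>i. i - m"]) auto
  finally show ?thesis .
qed

lemma des_conv_descents: "des n \<pi> = descents (map \<pi> [1..<Suc n])"
  unfolding des_def descents_conv_sum card_filter_conv_sum
  by (intro sum.cong) (auto simp del: upt_Suc)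

lemma val_conv_valleys: "val n \<pi> = valleys (map \<pi> [1..<Suc n])"
  unfolding val_def valleys_conv_sum card_filter_conv_sum
  by (intro sum.cong) (auto simp del: upt_Suc)

text \<open>A permutation of \<open>{1..n}\<close> fixes 0, so \<open>\<pi> 0 < \<pi> 1\<close> and
  the special clause for \<open>i = 1\<close> becomes the ordinary peak condition.\<close>

lemma lpk_conv_peaks:
  assumes "\<pi> permutes {1..n}"
  shows "lpk n \<pi> = peaks (0 # map \<pi> [1..<Suc n])"
proof -
  have 0: "\<pi> 0 = 0" using assms by (auto simp: permutes_def)
  have pos: "0 < \<pi> 1" if "1 \<le> n"
    using permutes_in_image[OF assms, of 1] that by auto
  have "0 # map \<pi> [1..<Suc n] = map \<pi> [0..<Suc n]"
    by (subst (2) upt_conv_Cons) (auto simp: 0 simp del: upt_Suc)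
  moreover have "lpk n \<pi> = card {i \<in> {1..n - 1}. \<pi> (i - 1) < \<pi> i \<and> \<pi> (i + 1) < \<pi> i}"
    unfolding lpk_def
  proof (intro arg_cong[of _ _ card] Collect_cong conj_cong refl)
    fix i assume "i \<in> {1..n - 1}"
    then show "(2 \<le> i \<and> \<pi> (i - 1) < \<pi> i \<and> \<pi> (i + 1) < \<pi> i \<or> i = 1 \<and> \<pi> 2 < \<pi> 1) \<longleftrightarrow>
      \<pi> (i - 1) < \<pi> i \<and> \<pi> (i + 1) < \<pi> i"
      using 0 pos by (cases "i = 1") (auto simp: numeral_2_eq_2)
  qed
  ultimately show ?thesis
    unfolding peaks_conv_sum card_filter_conv_sum
    by (auto intro!: sum.cong simp del: upt_Suc)
qed

lemma bij_betw_map_permutes: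
  "bij_betw (\<lambda>\<pi>. map \<pi> [1..<Suc n]) {\<pi>. \<pi> permutes {1..n}} (permutations_of_set {1..n})"
proof -
  let ?f = "\<lambda>\<pi>. map \<pi> [1..<Suc n]"
  have set: "set [1..<Suc n] = {1..n}" by auto
  have inj: "inj_on ?f {\<pi>. \<pi> permutes {1..n}}"
  proof (rule inj_onI)
    fix \<pi> \<sigma> assume *: "\<pi> \<in> {\<pi>. \<pi> permutes {1..n}}" "\<sigma> \<in> {\<pi>. \<pi> permutes {1..n}}" "?f \<pi> = ?f \<sigma>"
    then have "\<pi> i = \<sigma> i" if "i \<in> {1..n}" for i
      using that set by (metis map_eq_conv)
    then show "\<pi> = \<sigma>" using * by (intro ext) (metis mem_Collect_eq permutes_def)
  qed
  moreover have sub: "?f ` {\<pi>. \<pi> permutes {1..n}} \<subseteq> permutations_of_set {1..n}"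
  proof safe
    fix \<pi> assume "\<pi> permutes {1..n}"
    then have "inj_on \<pi> {1..n}" "\<pi> ` {1..n} = {1..n}"
      by (auto simp: permutes_inj_on permutes_image)
    then show "?f \<pi> \<in> permutations_of_set {1..n}"
      using set by (intro permutations_of_setI) (auto simp: distinct_map simp del: upt_Suc)
  qed
  \<comment> \<open>Surjectivity follows by counting: both sets have \<open>fact n\<close>
    elements.\<close>
  moreover have "card (permutations_of_set {1..n}) \<le> card (?f ` {\<pi>. \<pi> permutes {1..n}})"
    unfolding card_image[OF inj] by (subst card_permutations[of "{1..n}" n]) simp_all
  ultimately have "?f ` {\<pi>. \<pi> permutes {1..n}} = permutations_of_set {1..n}"
    by (intro card_seteq) auto
  with inj show ?thesis unfolding bij_betw_def ..
qed

lemma P_lpk_val_des_conv_sum: "P_lpk_val_des n y z t = lpk_val_des_sum y z t {1..n}"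
proof -
  have "P_lpk_val_des n y z t =
    (\<Sum>\<pi> | \<pi> permutes {1..n}. lpk_val_des_weight y z t (map \<pi> [1..<Suc n]))"
    unfolding P_lpk_val_des_def lpk_val_des_weight_def
    by (intro sum.cong) (auto simp: lpk_conv_peaks val_conv_valleys des_conv_descents simp del: upt_Suc)
  also have "\<dots> = lpk_val_des_sum y z t {1..n}"
    unfolding lpk_val_des_sum_def by (rule sum.reindex_bij_betw[OF bij_betw_map_permutes])
  finally show ?thesis .
qed

section \<open>The recurrence and its scaling symmetry\<close>

text \<open>The value at \<open>n = 0\<close> is changed from 1 to 0, so that the recurrence needs no side conditions.\<close>
definition P0 :: "nat \<Rightarrow> 'a::comm_ring_1 \<Rightarrow> 'a \<Rightarrow> 'a \<Rightarrow> 'a" where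
  "P0 n y z t = (if n = 0 then 0 else P_lpk_val_des n y z t)"

lemma P0_0 [simp]: "P0 0 y z t = 0"
  by (simp add: P0_def)

text \<open>The least letter comes first, last or in between; this gives the term
  \<open>P0 n y z t\<close>, the term with \<open>y * t\<close> but no \<open>z\<close>, and the
  convolution, whose end terms vanish. The \<open>of_bool\<close> accounts for the one-letter
  word.\<close>

lemma P0_Suc:
  "P0 (Suc n) y z t = of_bool (n = 0) + P0 n y z t + y * t * P0 n 1 (y * z) t +
     y * z * t * (\<Sum>k\<le>n. of_nat (n choose k) * (P0 k 1 (y * z) t * P0 (n - k) y z t))"
proof (cases "n = 0")
  case True
  then show ?thesis
    by (simp add: P0_def P_lpk_val_des_conv_sum lpk_val_des_sum_Suc del: One_nat_def)
next
  case False
  have "P0 (Suc n) y z t =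
    (\<Sum>k\<le>n. of_nat (n choose k) * (if k = 0 then lpk_val_des_sum y z t {1..n} else
       y * t * (if n - k = 0 then 1 else z) *
        (lpk_val_des_sum 1 (y * z) t {1..k} * lpk_val_des_sum y z t {1..n - k})))"
    unfolding lpk_val_des_sum_Suc[symmetric] by (simp add: P0_def P_lpk_val_des_conv_sum)
  also have "\<dots> = (\<Sum>k\<le>n. (if k = 0 then P0 n y z t else 0) +
      (if k = n then y * t * P0 n 1 (y * z) t else 0) +
      y * z * t * (of_nat (n choose k) * (P0 k 1 (y * z) t * P0 (n - k) y z t)))"
    using False by (intro sum.cong) (auto simp: P0_def P_lpk_val_des_conv_sum mult_ac)
  also have "\<dots> = P0 n y z t + y * t * P0 n 1 (y * z) t +
     y * z * t * (\<Sum>k\<le>n. of_nat (n choose k) * (P0 k 1 (y * z) t * P0 (n - k) y z t))"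
    by (simp add: sum.distrib sum_distrib_left)
  finally show ?thesis using False by simp
qed

lemma eulerian_conv_P0: "eulerian n t = of_bool (n = 0) + t * P0 n 1 1 t"
  by (simp add: eulerian_def P0_def P_lpk_val_des_def sum_distrib_left)

text \<open>
  The factors \<open>a\<close> and \<open>b\<close> clear the denominators: the recurrence \<open>P0_Suc\<close> is homogeneous under
  \<open>1 + t \<mapsto> \<kappa> (1 + t)\<close>, \<open>z t \<mapsto> \<kappa>\<^sup>2 z t\<close>, where \<open>\<kappa> = b / a\<close>.
\<close>
lemma P0_rescale:
  assumes "b * (1 + t) = a * (1 + s)" "b ^ 2 * (x * t) = a ^ 2 * (w * s)"
  shows "a ^ n * P0 (Suc n) 1 w s = b ^ n * P0 (Suc n) 1 x t"
proof (induction n rule: less_induct)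
  case (less n)
  show ?case
  proof (cases n)
    case 0
    then show ?thesis by (simp add: P0_Suc)
  next
    case (Suc m)
    have conv: "a ^ n * (w * s * (P0 k 1 w s * P0 (n - k) 1 w s)) =
      b ^ n * (x * t * (P0 k 1 x t * P0 (n - k) 1 x t))" if kn: "k \<le> n" for k
    \<comment> \<open>End terms vanish with \<open>P0 0\<close>. Otherwise the two factors absorb
      only the exponents \<open>i\<close> and \<open>j\<close> with \<open>i + j = n - 2\<close>,
      and the remaining square goes to \<open>w * s\<close>.\<close>
    proof (cases "k = 0 \<or> k = n")
      case False
      then obtain i where i: "k = Suc i" by (cases k) auto
      obtain j where j: "n - k = Suc j" using False kn by (cases "n - k") auto
      have n: "n = Suc (Suc (i + j))" using i j by linarith
      have "a ^ n * (w * s * (P0 k 1 w s * P0 (n - k) 1 w s)) =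
        (a ^ 2 * (w * s)) * ((a ^ i * P0 (Suc i) 1 w s) * (a ^ j * P0 (Suc j) 1 w s))"
        unfolding i[symmetric] j[symmetric]
        by (simp add: n power2_eq_square power_add mult_ac)
      also have "\<dots> = (b ^ 2 * (x * t)) * ((b ^ i * P0 (Suc i) 1 x t) * (b ^ j * P0 (Suc j) 1 x t))"
        using n by (simp add: less.IH assms(2))
      also have "\<dots> = b ^ n * (x * t * (P0 k 1 x t * P0 (n - k) 1 x t))"
        unfolding i[symmetric] j[symmetric]
        by (simp add: n power2_eq_square power_add mult_ac)
      finally show ?thesis .
    qed auto
    have lin: "a ^ n * ((1 + s) * P0 n 1 w s) = b ^ n * ((1 + t) * P0 n 1 x t)"
    proof -
      have "a ^ n * ((1 + s) * P0 n 1 w s) = (a * (1 + s)) * (a ^ m * P0 (Suc m) 1 w s)"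
        by (simp add: Suc mult_ac)
      also have "\<dots> = (b * (1 + t)) * (b ^ m * P0 (Suc m) 1 x t)"
        using Suc by (simp add: less.IH assms(1))
      finally show ?thesis by (simp add: Suc mult_ac)
    qed
    have "n \<noteq> 0" using Suc by simp
    have *: "c ^ n * P0 (Suc n) 1 u r = c ^ n * ((1 + r) * P0 n 1 u r) +
      (\<Sum>k\<le>n. of_nat (n choose k) * (c ^ n * (u * r * (P0 k 1 u r * P0 (n - k) 1 u r))))"
      for c u r :: 'a
      using \<open>n \<noteq> 0\<close> by (simp add: P0_Suc[of n] sum_distrib_left algebra_simps)
    have "(\<Sum>k\<le>n. of_nat (n choose k) * (a ^ n * (w * s * (P0 k 1 w s * P0 (n - k) 1 w s)))) =
      (\<Sum>k\<le>n. of_nat (n choose k) * (b ^ n * (x * t * (P0 k 1 x t * P0 (n - k) 1 x t))))"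
      by (intro sum.cong) (auto simp: conv)
    then show ?thesis unfolding * lin by simp
  qed
qed

section \<open>Exponential generating functions and the linear differential equation\<close>

text \<open>The equation expresses \<open>of_nat (Suc m) * D $ Suc m\<close> through earlier
  coefficients, which vanish by induction; characteristic 0 permits the division.\<close>

lemma fps_deriv_linear_unique:
  fixes D :: "'a::field_char_0 fps"
  assumes "fps_deriv D = K * D" "D $ 0 = 0"
  shows "D = 0"
proof (rule fps_ext)
  fix n
  show "D $ n = 0 $ n"
  proof (induction n rule: less_induct)
    case (less n)
    show ?case
    proof (cases n)
      case (Suc m)
      have "of_nat (Suc m) * D $ Suc m = (K * D) $ m"
        using assms(1) by (metis fps_deriv_nth Suc_eq_plus1)
      also have "\<dots> = 0"
        using less Suc by (simp add: fps_mult_nth)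
      finally show ?thesis using Suc by (simp del: of_nat_Suc)
    qed (simp add: assms)
  qed
qed

definition egf :: "(nat \<Rightarrow> 'a::field_char_0) \<Rightarrow> 'a fps" where
  "egf f = Abs_fps (\<lambda>n. f n / fact n)"

lemma egf_nth [simp]: "egf f $ n = f n / fact n"
  by (simp add: egf_def)

lemma fps_deriv_egf: "fps_deriv (egf f) = egf (\<lambda>n. f (Suc n))"
  by (rule fps_ext) (simp add: field_simps del: of_nat_Suc)

lemma egf_mult: "egf f * egf g = egf (\<lambda>n. \<Sum>k\<le>n. of_nat (n choose k) * (f k * g (n - k)))"
  by (rule fps_ext)
    (auto simp: fps_mult_nth sum_divide_distrib binomial_fact atLeast0AtMost intro!: sum.cong)

lemma egf_exp: "egf (\<lambda>n. c ^ n) = fps_exp c"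
  by (rule fps_ext) simp

lemma fps_deriv_egf_P0:
  "fps_deriv (egf (\<lambda>n. P0 n y z t)) = 1 + egf (\<lambda>n. P0 n y z t) +
     fps_const (y * t) * egf (\<lambda>n. P0 n 1 (y * z) t) +
     fps_const (y * z * t) * (egf (\<lambda>n. P0 n 1 (y * z) t) * egf (\<lambda>n. P0 n y z t))"
  unfolding fps_deriv_egf egf_mult
  by (rule fps_ext) (auto simp: P0_Suc add_divide_distrib)


text \<open>
  In terms of exponential generating functions, both sides solve the linear differential equation
  \<open>R' = (\<alpha> + \<beta>) (1 + y t F) + (1 + y z t F) R\<close>. The equation for \<open>c\<close> makes \<open>exp ((1 - c) x) (1 + c F)\<close>
  a solution of the homogeneous equation, as \<open>F\<close> satisfies a Riccati equation.
\<close>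
lemma P0_conv_convolution:
  fixes c :: "'a::field_char_0"
  assumes c: "c ^ 2 + y * z * t = c * (1 + t)"
    and \<beta>: "\<beta> * t = (\<alpha> + \<beta>) * (y * t) - \<alpha> * (y * z * t)"
    and n: "n > 0"
  shows "(\<alpha> + \<beta>) * P0 n y z t = \<beta> * P0 n 1 (y * z) t + \<alpha> * ((1 - c) ^ n +
    c * (\<Sum>k\<le>n. of_nat (n choose k) * (P0 k 1 (y * z) t * (1 - c) ^ (n - k))))"
proof -
  let ?C = fps_const
  define F where "F = egf (\<lambda>n. P0 n 1 (y * z) t)"
  define P where "P = egf (\<lambda>n. P0 n y z t)"
  define E where "E = fps_exp (1 - c)"
  define G where "G = E * (1 + ?C c * F)"
  \<comment> \<open>Subtracting 1 makes the constant coefficient 0, as for \<open>P\<close>, without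
    changing coefficients at \<open>n > 0\<close>.\<close>
  define R where "R = ?C \<beta> * F + ?C \<alpha> * (G - 1)"
  have F': "fps_deriv F = 1 + F + ?C t * F + ?C (y * z * t) * (F * F)"
    unfolding F_def using fps_deriv_egf_P0[of 1 "y * z" t] by simp
  have P': "fps_deriv P = 1 + P + ?C (y * t) * F + ?C (y * z * t) * (F * P)"
    unfolding P_def F_def by (rule fps_deriv_egf_P0)
  have E': "fps_deriv E = ?C (1 - c) * E"
    by (simp add: E_def)
  have c': "?C c * ?C c + ?C (y * z * t) = ?C c * (1 + ?C t)"
    using arg_cong[OF c, of ?C] by (simp add: power2_eq_square flip: fps_const_add fps_const_mult fps_const_1_eq_1)
  have "fps_deriv G = G * (1 + ?C (y * z * t) * F)"
  proof -
    have one: "?C (1 - c) = 1 - ?C c" by (simp flip: fps_const_sub)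
    \<comment> \<open>Terms free of \<open>F\<close> and terms in \<open>F * F\<close> cancel; what
      remains contains the quadratic equation for \<open>c\<close> as a factor.\<close>
    have "fps_deriv G - G * (1 + ?C (y * z * t) * F) =
      - E * (?C c * ?C c + ?C (y * z * t) - ?C c * (1 + ?C t)) * F"
      unfolding G_def by (simp add: F' E' one algebra_simps del: fps_const_mult fps_const_neg)
    then show ?thesis unfolding c' by simp
  qed
  note G' = this
  have \<beta>': "?C \<beta> * ?C t = (?C \<alpha> + ?C \<beta>) * ?C (y * t) - ?C \<alpha> * ?C (y * z * t)"
    using arg_cong[OF \<beta>, of ?C] by (simp flip: fps_const_add fps_const_sub fps_const_mult)
  have R': "fps_deriv R = (?C \<alpha> + ?C \<beta>) * (1 + ?C (y * t) * F) + R * (1 + ?C (y * z * t) * F)"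
  proof -
    \<comment> \<open>Only a multiple of \<open>F\<close> survives, and the condition on
      \<open>\<beta>\<close> says that its factor is 0.\<close>
    have "fps_deriv R - ((?C \<alpha> + ?C \<beta>) * (1 + ?C (y * t) * F) + R * (1 + ?C (y * z * t) * F)) =
      (?C \<beta> * ?C t - ((?C \<alpha> + ?C \<beta>) * ?C (y * t) - ?C \<alpha> * ?C (y * z * t))) * F"
      unfolding R_def by (simp add: F' G' algebra_simps del: fps_const_mult fps_const_neg)
    then show ?thesis unfolding \<beta>' by simp
  qed
  define D where "D = (?C \<alpha> + ?C \<beta>) * P - R"
  have "D = 0"
  proof (rule fps_deriv_linear_unique)
    show "fps_deriv D = (1 + ?C (y * z * t) * F) * D"
      unfolding D_def by (simp add: P' R' algebra_simps del: fps_const_mult fps_const_add fps_const_neg)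
    show "D $ 0 = 0"
      by (simp add: D_def R_def G_def P_def F_def E_def)
  qed
  then have "((?C \<alpha> + ?C \<beta>) * P) $ n = R $ n"
    by (simp add: D_def)
  moreover have "G = egf (\<lambda>n. (1 - c) ^ n + c * (\<Sum>k\<le>n. of_nat (n choose k) * (P0 k 1 (y * z) t * (1 - c) ^ (n - k))))"
  proof -
    have "G = E + ?C c * (F * E)" by (simp add: G_def algebra_simps)
    then show ?thesis
      unfolding F_def E_def egf_exp[symmetric] egf_mult
      by (auto intro!: fps_ext simp: add_divide_distrib)
  qed
  ultimately have "(\<alpha> + \<beta>) * (P0 n y z t / fact n) = \<beta> * (P0 n 1 (y * z) t / fact n) + \<alpha> * (((1 - c) ^ n +
    c * (\<Sum>k\<le>n. of_nat (n choose k) * (P0 k 1 (y * z) t * (1 - c) ^ (n - k)))) / fact n)"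
    using n by (simp add: R_def P_def F_def)
  then show ?thesis by (simp add: field_simps)
qed

section \<open>The rational substitution\<close>

text \<open>With \<open>s\<close>, \<open>u\<close>, \<open>v\<close>, \<open>w\<close> as in the
  proof, \<open>1 + w\<close> and \<open>u * v * w\<close> are \<open>1 + s\<close> and
  \<open>s\<close> scaled by \<open>(1 + y) / \<alpha>\<close> and by its square. Hence
  \<open>P0_rescale\<close> turns the auxiliary sequence \<open>f\<close> into Eulerian polynomials
  at \<open>t\<^sup>2\<close>.\<close>

lemma eulerian_convolution:
  fixes y t :: "'a::field_char_0"
  assumes t: "t \<noteq> 0" and nz: "y + t\<^sup>2 \<noteq> 0" "1 + y * t \<noteq> 0" "1 + y * t\<^sup>2 \<noteq> 0" "y + t \<noteq> 0" and "n \<ge> 1"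
  shows "(1 + y) ^ n / t * eulerian n (t ^ 2)
           + (\<Sum>k=0..n. of_nat (n choose k) * (1 + y) ^ k * (1 - t ^ 2) ^ (n - k) * eulerian k (t ^ 2))
         = (1 + y * t) * (1 + t) * (1 + y * t ^ 2) ^ (n - 1)
           * P_lpk_val_des n
               (t * (1 + y) * (y + t) / ((y + t ^ 2) * (1 + y * t)))
               (t * (1 + y) * (1 + y * t) / ((1 + y * t ^ 2) * (y + t)))
               ((y + t ^ 2) / (1 + y * t ^ 2))"
proof -
  define s where "s = t\<^sup>2"
  define u where "u = t * (1 + y) * (y + t) / ((y + s) * (1 + y * t))"
  define v where "v = t * (1 + y) * (1 + y * t) / ((1 + y * s) * (y + t))"
  define w where "w = (y + s) / (1 + y * s)"
  \<comment> \<open>The sum \<open>\<alpha> + \<beta>\<close> factors as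
    \<open>(1 + y * t) * (1 + t)\<close>, the prefactor in the identity.\<close>
  define \<alpha> where "\<alpha> = 1 + y * s"
  define \<beta> where "\<beta> = t * (1 + y)"
  \<comment> \<open>A root of the quadratic in \<open>P0_conv_convolution\<close>, the other being
    \<open>(1 + y) / \<alpha>\<close>. This one satisfies \<open>1 - c = (1 - s) / \<alpha>\<close>,
    the source of the powers of \<open>1 - t\<^sup>2\<close>.\<close>
  define c where "c = \<beta> * t / \<alpha>"
  define f where "f = (\<lambda>k. P0 k 1 (u * v) w)"
  have \<alpha>0: "\<alpha> \<noteq> 0" using nz by (simp add: \<alpha>_def s_def)
  have nzs: "y + s \<noteq> 0" "1 + y * s \<noteq> 0" using nz by (auto simp: s_def)
  have w: "\<alpha> * (1 + w) = (1 + y) * (1 + s)"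
    using nzs by (simp add: w_def \<alpha>_def field_simps)
  have uvw: "\<alpha>\<^sup>2 * (u * v * w) = (1 + y)\<^sup>2 * (1 * s)"
    using nz nzs by (simp add: w_def u_def v_def \<alpha>_def s_def power2_eq_square)
  have uw: "(\<alpha> + \<beta>) * (u * w) = \<beta> * (y + t) * (1 + t) / \<alpha>"
  proof -
    have "\<alpha> + \<beta> = (1 + y * t) * (1 + t)"
      by (simp add: \<alpha>_def \<beta>_def s_def power2_eq_square algebra_simps)
    then show ?thesis
      using nz nzs by (simp add: u_def w_def \<alpha>_def \<beta>_def mult_ac)
  qed
  have \<alpha>c: "\<alpha> * c = \<beta> * t" "\<alpha> * (1 - c) = 1 - s"
    using \<alpha>0 by (simp_all add: c_def right_diff_distrib) (simp add: \<alpha>_def \<beta>_def s_def power2_eq_square algebra_simps)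
  have c: "c\<^sup>2 + u * v * w = c * (1 + w)"
  proof -
    have "\<alpha>\<^sup>2 * (c\<^sup>2 + u * v * w) = (\<alpha> * c)\<^sup>2 + \<alpha>\<^sup>2 * (u * v * w)"
      by (simp add: algebra_simps)
    also have "\<dots> = (\<beta> * t) * ((1 + y) * (1 + s))"
      unfolding \<alpha>c uvw by (simp add: \<beta>_def s_def power2_eq_square algebra_simps)
    also have "\<dots> = \<alpha>\<^sup>2 * (c * (1 + w))"
      unfolding w[symmetric] \<alpha>c[symmetric] by (simp add: power2_eq_square mult_ac)
    finally show ?thesis using \<alpha>0 by simp
  qed
  have \<beta>: "\<beta> * w = (\<alpha> + \<beta>) * (u * w) - \<alpha> * (u * v * w)"
  proof -
    have "\<alpha> * (\<beta> * w) = \<beta> * (y + s)"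
      using \<alpha>0 by (simp add: w_def flip: \<alpha>_def)
    also have "\<dots> = \<beta> * (y + t) * (1 + t) - (1 + y)\<^sup>2 * s"
      by (simp add: \<beta>_def s_def power2_eq_square algebra_simps)
    also have "\<dots> = \<alpha> * ((\<alpha> + \<beta>) * (u * w) - \<alpha> * (u * v * w))"
      using \<alpha>0 uvw unfolding uw by (simp add: power2_eq_square right_diff_distrib mult_ac)
    finally show ?thesis using \<alpha>0 by simp
  qed
  have main: "(\<alpha> + \<beta>) * P0 n u v w = \<beta> * f n + \<alpha> * ((1 - c) ^ n +
    c * (\<Sum>k\<le>n. of_nat (n choose k) * (f k * (1 - c) ^ (n - k))))"
    unfolding f_def using c \<beta> assms(6) by (intro P0_conv_convolution) auto
  \<comment> \<open>The extra factors \<open>\<alpha>\<close> and \<open>1 + y\<close> avoid the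
    exponent \<open>k - 1\<close> of the rescaling, so that \<open>k = 0\<close> is covered.\<close>
  have f: "(1 + y) ^ k * P0 k 1 1 s * \<alpha> = (1 + y) * \<alpha> ^ k * f k" for k
  proof (cases k)
    case 0
    then show ?thesis by (simp add: f_def)
  next
    case (Suc m)
    have "(1 + y) ^ m * P0 (Suc m) 1 1 s = \<alpha> ^ m * P0 (Suc m) 1 (u * v) w"
      using w uvw by (intro P0_rescale) auto
    then show ?thesis using Suc by (simp add: f_def mult_ac)
  qed
  have eul: "(1 + y) ^ k * eulerian k s = of_bool (k = 0) + c * \<alpha> ^ k * f k" for k
  proof -
    have "\<alpha> * ((1 + y) ^ k * (s * P0 k 1 1 s)) = s * (1 + y) * \<alpha> ^ k * f k"
      using f[of k] by (simp add: mult_ac)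
    also have "\<dots> = \<alpha> * (c * \<alpha> ^ k * f k)"
      using \<alpha>c(1) by (simp add: \<beta>_def s_def power2_eq_square mult_ac)
    finally have "(1 + y) ^ k * (s * P0 k 1 1 s) = c * \<alpha> ^ k * f k"
      using \<alpha>0 by simp
    then show ?thesis by (cases "k = 0") (simp_all add: eulerian_conv_P0 mult_ac)
  qed
  \<comment> \<open>The 1 in \<open>eulerian 0 s\<close> contributes \<open>(1 - s) ^ n\<close>,
    which becomes the isolated power of \<open>1 - c\<close> in \<open>main\<close>.\<close>
  have "(\<Sum>k=0..n. of_nat (n choose k) * (1 + y) ^ k * (1 - s) ^ (n - k) * eulerian k s) =
    (\<Sum>k\<le>n. (if k = 0 then (1 - s) ^ n else 0) +
       \<alpha> ^ n * (c * (of_nat (n choose k) * (f k * (1 - c) ^ (n - k)))))"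
  proof (rule sum.cong)
    fix k assume "k \<in> {..n}"
    then have "\<alpha> ^ n = \<alpha> ^ k * \<alpha> ^ (n - k)" by (simp flip: power_add)
    then have "\<alpha> ^ n * (1 - c) ^ (n - k) = \<alpha> ^ k * (1 - s) ^ (n - k)"
      by (simp flip: \<alpha>c(2) add: power_mult_distrib)
    then have *: "\<alpha> ^ n * (c * (of_nat (n choose k) * (f k * (1 - c) ^ (n - k)))) =
        of_nat (n choose k) * (1 - s) ^ (n - k) * (c * \<alpha> ^ k * f k)"
      by (simp add: mult_ac)
    have "of_nat (n choose k) * (1 + y) ^ k * (1 - s) ^ (n - k) * eulerian k s =
      of_nat (n choose k) * (1 - s) ^ (n - k) * ((1 + y) ^ k * eulerian k s)"
      by (simp add: mult_ac)
    then show "of_nat (n choose k) * (1 + y) ^ k * (1 - s) ^ (n - k) * eulerian k s =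
      (if k = 0 then (1 - s) ^ n else 0) +
       \<alpha> ^ n * (c * (of_nat (n choose k) * (f k * (1 - c) ^ (n - k))))"
      unfolding * eul by (simp add: algebra_simps)
  qed auto
  also have "\<dots> = \<alpha> ^ n * ((1 - c) ^ n + c * (\<Sum>k\<le>n. of_nat (n choose k) * (f k * (1 - c) ^ (n - k))))"
    by (simp add: sum.distrib sum_distrib_left distrib_left flip: \<alpha>c(2) power_mult_distrib)
  finally have sum: "(\<Sum>k=0..n. of_nat (n choose k) * (1 + y) ^ k * (1 - s) ^ (n - k) * eulerian k s) = \<dots>" .
  have \<alpha>n: "\<alpha> ^ n = \<alpha> ^ (n - 1) * \<alpha>"
    using assms(6) by (simp flip: power_Suc2)
  \<comment> \<open>By \<open>\<alpha> * c = \<beta> * t\<close> the denominator cancels, leaving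
    the \<open>\<beta>\<close> term of \<open>main\<close>.\<close>
  have "(1 + y) ^ n / t * eulerian n s = \<alpha> ^ (n - 1) * (\<beta> * f n)"
  proof -
    have "(1 + y) ^ n / t * eulerian n s = \<alpha> ^ (n - 1) * (\<alpha> * c) * f n / t"
      using eul[of n] assms(6) by (simp add: \<alpha>n mult_ac)
    then show ?thesis using t by (simp add: \<alpha>c mult_ac)
  qed
  then have "(1 + y) ^ n / t * eulerian n s +
      (\<Sum>k=0..n. of_nat (n choose k) * (1 + y) ^ k * (1 - s) ^ (n - k) * eulerian k s) =
    \<alpha> ^ (n - 1) * ((\<alpha> + \<beta>) * P0 n u v w)"
    unfolding sum main \<alpha>n by (simp add: distrib_left mult_ac)
  also have "\<alpha> + \<beta> = (1 + y * t) * (1 + t)"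
    by (simp add: \<alpha>_def \<beta>_def s_def power2_eq_square algebra_simps)
  also have "P0 n u v w = P_lpk_val_des n u v w"
    using assms(6) by (simp add: P0_def)
  finally show ?thesis
    unfolding u_def v_def w_def \<alpha>_def s_def by (simp only: mult_ac)
qed

section \<open>The field of rational functions\<close>

text \<open>Characteristic 0 carries over to the fraction field, so the generating function argument
  applies to \<open>ratfun\<close>.\<close>

instance fract :: ("{idom, ring_char_0}") ring_char_0
proof
  show "inj (of_nat :: nat \<Rightarrow> 'a fract)"
    by (intro injI) (simp add: of_nat_fract eq_fract)
qed

instance fract :: ("{idom, ring_char_0}") field_char_0 ..

theorem theorem4p15:
  fixes n :: nat
  assumes "n \<ge> 1"
  shows "(1 + Y) ^ n / T * eulerian n (T ^ 2)
           + (\<Sum>k=0..n. of_nat (n choose k) * (1 + Y) ^ k * (1 - T ^ 2) ^ (n - k) * eulerian k (T ^ 2))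
         = (1 + Y * T) * (1 + T) * (1 + Y * T ^ 2) ^ (n - 1)
           * P_lpk_val_des n
               (T * (1 + Y) * (Y + T) / ((Y + T ^ 2) * (1 + Y * T)))
               (T * (1 + Y) * (1 + Y * T) / ((1 + Y * T ^ 2) * (Y + T)))
               ((Y + T ^ 2) / (1 + Y * T ^ 2))"
proof (rule eulerian_convolution[OF _ _ _ _ _ assms])
  show "T \<noteq> 0" by (simp add: T_def)
  \<comment> \<open>Each expression is the image under \<open>to_fract\<close> of a polynomial whose
    coefficients show that it is nonzero.\<close>
  show "Y + T\<^sup>2 \<noteq> 0" "1 + Y * T \<noteq> 0" "1 + Y * T\<^sup>2 \<noteq> 0" "Y + T \<noteq> 0"
    unfolding Y_def T_def to_fract_1[symmetric] power2_eq_square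
      to_fract_mult[symmetric] to_fract_add[symmetric] to_fract_eq_0_iff
    by (simp_all add: one_pCons)
qed

end
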